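(* The following are equivalent for a group $G$: (1) $G$ is allosteric. (2) For every finite normal subgroup $H$ of $G$, the group $G/H$ is allosteric.
   Context: Groups are countable, discrete and finitely generated. An action of $G$ by homeomorphisms on a compact Hausdorff space $X$ is minimal if $X$ is the only non-empty closed invariant subset, and topologically free if the set of points with trivial stabilizer is residual. An ergodic measure is a $G$-invariant Borel probability measure for which invariant Borel sets have measure $0$ or $1$; the action is essentially free with respect to $\mu$ if $\mu$-a.e. point has trivial stabilizer. $G$ is allosteric if there exists a minimal topologically free action of $G$ on a compact Hausdorff space, with an ergodic measure with respect to which the action is not essentially free. *)

theory Defs
  imports "HOL-Algebra.Group_Action" "HOL-Algebra.Generated_Groups" "HOL-Probability.Probability"
begin

definition finitely_generated_group :: "('g, 'm) monoid_scheme \<Rightarrow> bool" where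
  "finitely_generated_group G \<longleftrightarrow>
     group G \<and> (\<exists>A. finite A \<and> A \<subseteq> carrier G \<and> generate G A = carrier G)"

definition action_by_homeos ::
    "('g, 'm) monoid_scheme \<Rightarrow> 'x topology \<Rightarrow> ('g \<Rightarrow> 'x \<Rightarrow> 'x) \<Rightarrow> bool" where
  "action_by_homeos G X \<phi> \<longleftrightarrow>
     group_action G (topspace X) \<phi> \<and> (\<forall>g\<in>carrier G. homeomorphic_map X X (\<phi> g))"

definition invariant_set ::
    "('g, 'm) monoid_scheme \<Rightarrow> ('g \<Rightarrow> 'x \<Rightarrow> 'x) \<Rightarrow> 'x set \<Rightarrow> bool" where
  "invariant_set G \<phi> A \<longleftrightarrow> (\<forall>g\<in>carrier G. \<phi> g ` A = A)"

definition minimal_action ::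
    "('g, 'm) monoid_scheme \<Rightarrow> 'x topology \<Rightarrow> ('g \<Rightarrow> 'x \<Rightarrow> 'x) \<Rightarrow> bool" where
  "minimal_action G X \<phi> \<longleftrightarrow>
     topspace X \<noteq> {} \<and>
     (\<forall>C. closedin X C \<and> invariant_set G \<phi> C \<and> C \<noteq> {} \<longrightarrow> C = topspace X)"

definition residual_in :: "'x topology \<Rightarrow> 'x set \<Rightarrow> bool" where
  "residual_in X S \<longleftrightarrow> S \<subseteq> topspace X \<and>
     (\<exists>\<U>. countable \<U> \<and> (\<forall>U\<in>\<U>. openin X U \<and> X closure_of U = topspace X) \<and>
          topspace X \<inter> \<Inter>\<U> \<subseteq> S)"

definition topologically_free ::
    "('g, 'm) monoid_scheme \<Rightarrow> 'x topology \<Rightarrow> ('g \<Rightarrow> 'x \<Rightarrow> 'x) \<Rightarrow> bool" where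
  "topologically_free G X \<phi> \<longleftrightarrow>
     residual_in X {x \<in> topspace X. stabilizer G \<phi> x = {\<one>\<^bsub>G\<^esub>}}"

definition borel_sigma :: "'x topology \<Rightarrow> 'x measure" where
  "borel_sigma X = sigma (topspace X) {U. openin X U}"

text \<open>For \<open>A\<close> Borel, \<open>\<phi> g ` A\<close> is the preimage of \<open>A\<close> under the action of the inverse of \<open>g\<close>,
  so images may be used below in place of preimages. No regularity of \<open>M\<close> is required.\<close>

definition ergodic_measure ::
    "('g, 'm) monoid_scheme \<Rightarrow> 'x topology \<Rightarrow> ('g \<Rightarrow> 'x \<Rightarrow> 'x) \<Rightarrow> 'x measure \<Rightarrow> bool" where
  "ergodic_measure G X \<phi> M \<longleftrightarrow>
     prob_space M \<and> sets M = sets (borel_sigma X) \<and>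
     (\<forall>g\<in>carrier G. \<forall>A\<in>sets M. measure M (\<phi> g ` A) = measure M A) \<and>
     (\<forall>A\<in>sets M. invariant_set G \<phi> A \<longrightarrow> measure M A = 0 \<or> measure M A = 1)"

definition essentially_free ::
    "('g, 'm) monoid_scheme \<Rightarrow> ('g \<Rightarrow> 'x \<Rightarrow> 'x) \<Rightarrow> 'x measure \<Rightarrow> bool" where
  "essentially_free G \<phi> M \<longleftrightarrow> (AE x in M. stabilizer G \<phi> x = {\<one>\<^bsub>G\<^esub>})"

definition allosteric_action ::
    "('g, 'm) monoid_scheme \<Rightarrow> 'x topology \<Rightarrow> ('g \<Rightarrow> 'x \<Rightarrow> 'x) \<Rightarrow> bool" where
  "allosteric_action G X \<phi> \<longleftrightarrow>
     compact_space X \<and> Hausdorff_space X \<and> action_by_homeos G X \<phi> \<and>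
     minimal_action G X \<phi> \<and> topologically_free G X \<phi> \<and>
     (\<exists>M. ergodic_measure G X \<phi> M \<and> \<not> essentially_free G \<phi> M)"

text \<open>HOL cannot quantify over all spaces \<open>X\<close> of all types inside a definition. A compact Hausdorff
  space with a minimal action of a countable group has a countable dense subset (any orbit), hence
  embeds as a set into \<open>nat set set\<close>. So for countable \<open>G\<close> it is no restriction to let \<open>X\<close> range
  over all topologies whose underlying set is a subset of this type; see \<open>allostericI\<close>.\<close>

definition allosteric :: "('g, 'm) monoid_scheme \<Rightarrow> bool" where
  "allosteric G \<longleftrightarrow>
     group G \<and> (\<exists>(X :: nat set set topology) \<phi>. allosteric_action G X \<phi>)"

lemma space_borel_sigma [simp]: "space (borel_sigma X) = topspace X"
proof -
  have "{U. openin X U} \<subseteq> Pow (topspace X)" using openin_subset by blast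
  then show ?thesis by (simp add: borel_sigma_def)
qed

lemma measurable_borel_sigma:
  assumes "continuous_map X Y p"
  shows "p \<in> measurable (borel_sigma X) (borel_sigma Y)"
proof -
  have "p \<in> measurable (borel_sigma X) (sigma (topspace Y) {U. openin Y U})"
  proof (rule measurable_measure_of)
    show "{U. openin Y U} \<subseteq> Pow (topspace Y)" using openin_subset by blast
    show "p \<in> space (borel_sigma X) \<rightarrow> topspace Y"
      using assms by (simp add: continuous_map_def)
    fix V assume "V \<in> {U. openin Y U}"
    then have "openin X {x \<in> topspace X. p x \<in> V}" using assms by (simp add: continuous_map_def)
    then have "{x \<in> topspace X. p x \<in> V} \<in> sets (borel_sigma X)"
      unfolding borel_sigma_def by (intro in_measure_of) (auto dest: openin_subset)
    moreover have "p -` V \<inter> space (borel_sigma X) = {x \<in> topspace X. p x \<in> V}"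
      by auto
    ultimately show "p -` V \<inter> space (borel_sigma X) \<in> sets (borel_sigma X)" by simp
  qed
  then show ?thesis by (simp add: borel_sigma_def)
qed

lemma allosteric_action_transport:
  fixes G (structure) and X :: "'x topology" and Y :: "'y topology"
  assumes act: "allosteric_action G X \<phi>" and hom: "homeomorphic_maps X Y f k"
  shows "allosteric_action G Y (\<lambda>g. \<lambda>y\<in>topspace Y. f (\<phi> g (k y)))"
proof -
  define \<psi> where "\<psi> = (\<lambda>g. \<lambda>y\<in>topspace Y. f (\<phi> g (k y)))"
  have fX: "f ` topspace X = topspace Y" and kY: "k ` topspace Y = topspace X"
    and kf: "\<And>x. x \<in> topspace X \<Longrightarrow> k (f x) = x"
    and fk: "\<And>y. y \<in> topspace Y \<Longrightarrow> f (k y) = y"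
    and hf: "homeomorphic_map X Y f" and hk: "homeomorphic_map Y X k"
    using hom by (auto simp: homeomorphic_maps_map homeomorphic_imp_surjective_map)
  have fin: "\<And>x. x \<in> topspace X \<Longrightarrow> f x \<in> topspace Y"
    and kin: "\<And>y. y \<in> topspace Y \<Longrightarrow> k y \<in> topspace X"
    using fX kY by auto
  from act obtain M where
    cX: "compact_space X" and HX: "Hausdorff_space X" and hact: "action_by_homeos G X \<phi>"
    and minX: "minimal_action G X \<phi>" and freeX: "topologically_free G X \<phi>"
    and erg: "ergodic_measure G X \<phi> M" and nef: "\<not> essentially_free G \<phi> M"
    unfolding allosteric_action_def by blast
  interpret A: group_action G "topspace X" \<phi>
    using hact by (simp add: action_by_homeos_def)
  have grp: "group G" using A.group_hom by (simp add: group_hom_def)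
  have hphi: "homeomorphic_map X X (\<phi> g)" if "g \<in> carrier G" for g
    using hact that by (simp add: action_by_homeos_def)
  have phin: "\<phi> g x \<in> topspace X" if "g \<in> carrier G" "x \<in> topspace X" for g x
    using A.surj_prop[OF that(1)] that(2) by blast
  have psi_f: "\<psi> g (f x) = f (\<phi> g x)" if "x \<in> topspace X" for g x
    using that by (simp add: \<psi>_def fin kf)
  have psi_img': "k ` (\<psi> g ` B) = \<phi> g ` (k ` B)"
    if "B \<subseteq> topspace Y" "g \<in> carrier G" for g B
  proof -
    have "k (\<psi> g y) = \<phi> g (k y)" if "y \<in> B" for y
      using that \<open>B \<subseteq> topspace Y\<close> \<open>g \<in> carrier G\<close> by (auto simp: \<psi>_def kf phin kin)
    then show ?thesis by (simp add: image_image)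
  qed
  have fkB: "f ` (k ` B) = B" if "B \<subseteq> topspace Y" for B
  proof -
    have "f (k y) = y" if "y \<in> B" for y
      using that \<open>B \<subseteq> topspace Y\<close> fk by blast
    then show ?thesis by (simp add: image_image)
  qed
  have hpsi: "homeomorphic_map Y Y (\<psi> g)" if "g \<in> carrier G" for g
  proof -
    have "homeomorphic_map Y Y (f \<circ> (\<phi> g \<circ> k))"
      by (intro homeomorphic_map_compose[OF _ hf] homeomorphic_map_compose[OF hk] hphi that)
    then show ?thesis
      by (rule homeomorphic_map_eq) (simp add: \<psi>_def)
  qed
  have Bij: "\<psi> g \<in> Bij (topspace Y)" if "g \<in> carrier G" for g
    using homeomorphic_imp_surjective_map[OF hpsi[OF that]]
      homeomorphic_imp_injective_map[OF hpsi[OF that]]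
    by (simp add: Bij_def bij_betw_def \<psi>_def)
  have gact: "group_action G (topspace Y) \<psi>"
  proof (intro group_action.intro group_hom.intro group_hom_axioms.intro grp group_BijGroup homI)
    fix g assume "g \<in> carrier G"
    then show "\<psi> g \<in> carrier (BijGroup (topspace Y))" using Bij by (simp add: BijGroup_def)
  next
    fix g h assume gh: "g \<in> carrier G" "h \<in> carrier G"
    have gh': "g \<otimes> h \<in> carrier G" using grp gh by (simp add: group.is_monoid monoid.m_closed)
    have "\<psi> (g \<otimes> h) = compose (topspace Y) (\<psi> g) (\<psi> h)"
    proof
      fix y show "\<psi> (g \<otimes> h) y = compose (topspace Y) (\<psi> g) (\<psi> h) y"
        using gh by (cases "y \<in> topspace Y")
          (auto simp: \<psi>_def compose_def A.composition_rule kin kf fin phin)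
    qed
    then show "\<psi> (g \<otimes> h) = \<psi> g \<otimes>\<^bsub>BijGroup (topspace Y)\<^esub> \<psi> h"
      using Bij gh by (simp add: BijGroup_def)
  qed
  have hactY: "action_by_homeos G Y \<psi>"
    using gact hpsi by (simp add: action_by_homeos_def)
  have inv_k: "invariant_set G \<phi> (k ` B)" if "invariant_set G \<psi> B" "B \<subseteq> topspace Y" for B
    using that psi_img'[OF that(2)] by (force simp: invariant_set_def)
  have minY: "minimal_action G Y \<psi>"
    unfolding minimal_action_def
  proof (intro conjI allI impI)
    show "topspace Y \<noteq> {}" using minX fX unfolding minimal_action_def by blast
    fix C assume C: "closedin Y C \<and> invariant_set G \<psi> C \<and> C \<noteq> {}"
    then have sub: "C \<subseteq> topspace Y" by (simp add: closedin_subset)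
    have "closedin X (k ` C)" using homeomorphic_map_closedness_eq[OF hk] C sub by blast
    with C inv_k[OF _ sub] minX have "k ` C = topspace X" by (auto simp: minimal_action_def)
    then show "C = topspace Y" using fkB[OF sub] fX by simp
  qed
  have stab: "stabilizer G \<psi> (f x) = stabilizer G \<phi> x" if "x \<in> topspace X" for x
  proof -
    have "f (\<phi> g x) = f x \<longleftrightarrow> \<phi> g x = x" if "g \<in> carrier G" for g
      using \<open>x \<in> topspace X\<close> that by (metis kf phin)
    then show ?thesis using that by (auto simp: stabilizer_def psi_f)
  qed
  let ?S = "{x \<in> topspace X. stabilizer G \<phi> x = {\<one>}}"
  let ?T = "{y \<in> topspace Y. stabilizer G \<psi> y = {\<one>}}"
  have T: "?T = f ` ?S"
  proof (intro equalityI subsetI)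
    fix y assume "y \<in> ?T"
    then have "k y \<in> ?S" "y = f (k y)" using stab[of "k y"] by (auto simp: kin fk)
    then show "y \<in> f ` ?S" by blast
  next
    fix y assume "y \<in> f ` ?S"
    then show "y \<in> ?T" using stab by (auto simp: fin)
  qed
  have freeY: "topologically_free G Y \<psi>"
  proof -
    from freeX obtain \<U> where U: "countable \<U>"
      "\<And>U. U \<in> \<U> \<Longrightarrow> openin X U \<and> X closure_of U = topspace X"
      "topspace X \<inter> \<Inter>\<U> \<subseteq> ?S"
      unfolding topologically_free_def residual_in_def by blast
    have "countable ((`) f ` \<U>)" using U(1) by simp
    moreover have "openin Y V \<and> Y closure_of V = topspace Y" if V: "V \<in> (`) f ` \<U>" for V
    proof -
      from V obtain U where VU: "V = f ` U" and U': "U \<in> \<U>" by blast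
      have "U \<subseteq> topspace X" using U(2)[OF U'] openin_subset by blast
      then show ?thesis
        using U(2)[OF U'] homeomorphic_map_closure_of[OF hf, of U]
          homeomorphic_map_openness[OF hf, of U] fX
        by (simp add: VU)
    qed
    moreover have "topspace Y \<inter> \<Inter>((`) f ` \<U>) \<subseteq> ?T"
    proof
      fix y assume y: "y \<in> topspace Y \<inter> \<Inter>((`) f ` \<U>)"
      have "k y \<in> U" if "U \<in> \<U>" for U
      proof -
        have "U \<subseteq> topspace X" using U(2)[OF that] openin_subset by blast
        moreover have "y \<in> f ` U" using y that by simp
        then obtain u where "u \<in> U" "y = f u" by (rule imageE)
        ultimately show ?thesis using kf[of u] by auto
      qed
      then have "k y \<in> ?S" using subsetD[OF U(3), of "k y"] y kin[of y] by blast
      moreover have "y = f (k y)" using y fk[of y] by simp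
      ultimately show "y \<in> ?T" unfolding T by (intro image_eqI)
    qed
    ultimately show ?thesis unfolding topologically_free_def residual_in_def by blast
  qed
  have cY: "compact_space Y" and HY: "Hausdorff_space Y"
    using cX HX homeomorphic_map_imp_homeomorphic_space[OF hf]
      homeomorphic_compact_space[of X Y] homeomorphic_Hausdorff_space[of X Y] by blast+
  have psM: "prob_space M" and setsM: "sets M = sets (borel_sigma X)"
    and invM: "\<And>g A. g \<in> carrier G \<Longrightarrow> A \<in> sets M \<Longrightarrow> measure M (\<phi> g ` A) = measure M A"
    and ergM: "\<And>A. A \<in> sets M \<Longrightarrow> invariant_set G \<phi> A \<Longrightarrow> measure M A = 0 \<or> measure M A = 1"
    using erg unfolding ergodic_measure_def by blast+
  have spM: "space M = topspace X" using sets_eq_imp_space_eq[OF setsM] space_borel_sigma by simp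
  have mf: "f \<in> measurable M (borel_sigma Y)"
    using measurable_borel_sigma[OF homeomorphic_imp_continuous_map[OF hf]] setsM measurable_cong_sets by blast
  define N where "N = distr M (borel_sigma Y) f"
  have sN: "sets N = sets (borel_sigma Y)" by (simp add: N_def)
  have subN: "B \<subseteq> topspace Y" if "B \<in> sets N" for B
    using sets.sets_into_space[OF that] by (simp add: N_def space_borel_sigma)
  have pre: "f -` B \<inter> space M = k ` B" if "B \<subseteq> topspace Y" for B
    using that fk kf kin by (force simp: spM)
  have kB: "k ` B \<in> sets M" if "B \<in> sets N" for B
    using measurable_sets[OF mf] that pre[OF subN[OF that]] sN by metis
  have mN: "measure N B = measure M (k ` B)" if "B \<in> sets N" for B
    using measure_distr[OF mf] that pre[OF subN[OF that]] sN by (simp add: N_def)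
  have psiB: "\<psi> g ` B \<in> sets N" if g: "g \<in> carrier G" and B: "B \<in> sets N" for g B
  proof -
    obtain q where q: "homeomorphic_maps Y Y (\<psi> g) q"
      using hpsi[OF g] homeomorphic_map_maps by blast
    then have "q \<in> measurable (borel_sigma Y) (borel_sigma Y)"
      by (simp add: measurable_borel_sigma homeomorphic_maps_def)
    then have "q -` B \<inter> topspace Y \<in> sets N"
      using measurable_sets[of q "borel_sigma Y" "borel_sigma Y" B] B sN space_borel_sigma by metis
    moreover have "q -` B \<inter> topspace Y = \<psi> g ` B"
    proof (intro equalityI subsetI)
      fix y assume "y \<in> q -` B \<inter> topspace Y"
      then have "q y \<in> B" "y = \<psi> g (q y)" using q by (auto simp: homeomorphic_maps_def)
      then show "y \<in> \<psi> g ` B" by blast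
    next
      fix y assume "y \<in> \<psi> g ` B"
      then obtain b where b: "b \<in> B" "y = \<psi> g b" by blast
      moreover from b have bY: "b \<in> topspace Y" using subN[OF B] by blast
      ultimately show "y \<in> q -` B \<inter> topspace Y"
        using q homeomorphic_imp_surjective_map[OF hpsi[OF g]]
        by (auto simp: homeomorphic_maps_def)
    qed
    ultimately show ?thesis by simp
  qed
  have ergY: "ergodic_measure G Y \<psi> N"
    unfolding ergodic_measure_def
  proof (intro conjI ballI impI)
    show "prob_space N" unfolding N_def by (rule prob_space.prob_space_distr[OF psM mf])
    show "sets N = sets (borel_sigma Y)" by (rule sN)
  next
    fix g B assume gB: "g \<in> carrier G" "B \<in> sets N"
    show "measure N (\<psi> g ` B) = measure N B"
      using mN[OF psiB[OF gB]] mN[OF gB(2)] psi_img'[OF subN[OF gB(2)] gB(1)]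
        invM[OF gB(1) kB[OF gB(2)]] by simp
  next
    fix B assume B: "B \<in> sets N" "invariant_set G \<psi> B"
    show "measure N B = 0 \<or> measure N B = 1"
      using ergM[OF kB[OF B(1)] inv_k[OF B(2) subN[OF B(1)]]] mN[OF B(1)] by simp
  qed
  have "\<not> essentially_free G \<psi> N"
  proof
    assume "essentially_free G \<psi> N"
    then obtain Z where Z: "Z \<in> null_sets N" "{y \<in> space N. stabilizer G \<psi> y \<noteq> {\<one>}} \<subseteq> Z"
      unfolding essentially_free_def by (auto simp: eventually_ae_filter)
    then have "Z \<in> sets N" by (simp add: null_setsD2)
    moreover have "emeasure M (k ` Z) = 0"
      using Z(1) emeasure_distr[OF mf] pre[OF subN[OF \<open>Z \<in> sets N\<close>]] sN
      by (auto simp: N_def null_sets_def)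
    ultimately have "k ` Z \<in> null_sets M" using kB by blast
    moreover have "{x \<in> space M. stabilizer G \<phi> x \<noteq> {\<one>}} \<subseteq> k ` Z"
    proof
      fix x assume x: "x \<in> {x \<in> space M. stabilizer G \<phi> x \<noteq> {\<one>}}"
      then have "f x \<in> Z" using Z(2) stab fin by (auto simp: spM N_def space_borel_sigma)
      moreover have "x = k (f x)" using kf[of x] x by (simp add: spM)
      ultimately show "x \<in> k ` Z" by (intro image_eqI)
    qed
    ultimately have "essentially_free G \<phi> M"
      unfolding essentially_free_def by (auto simp: eventually_ae_filter)
    with nef show False by simp
  qed
  then show ?thesis
    unfolding allosteric_action_def \<psi>_def[symmetric]
    using cY HY hactY minY freeY ergY by blast
qed

lemma minimal_action_orbit_dense:
  fixes G (structure)
  assumes hact: "action_by_homeos G X \<phi>" and minX: "minimal_action G X \<phi>" and x: "x \<in> topspace X"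
  shows "X closure_of ((\<lambda>g. \<phi> g x) ` carrier G) = topspace X"
proof -
  interpret A: group_action G "topspace X" \<phi>
    using hact by (simp add: action_by_homeos_def)
  interpret group G using A.group_hom by (simp add: group_hom_def)
  let ?O = "(\<lambda>g. \<phi> g x) ` carrier G"
  have sub: "?O \<subseteq> topspace X" using A.surj_prop x by blast
  have img: "\<phi> g ` ?O = ?O" if g: "g \<in> carrier G" for g
  proof (intro equalityI subsetI)
    fix y assume "y \<in> \<phi> g ` ?O"
    then obtain h where "h \<in> carrier G" "y = \<phi> g (\<phi> h x)" by blast
    then show "y \<in> ?O" using g x A.composition_rule by (metis image_eqI m_closed)
  next
    fix y assume "y \<in> ?O"
    then obtain h where h: "h \<in> carrier G" "y = \<phi> h x" by blast
    then have "y = \<phi> g (\<phi> (inv g \<otimes> h) x)"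
      using g x by (simp add: A.composition_rule[symmetric] m_assoc[symmetric])
    moreover have "inv g \<otimes> h \<in> carrier G" using g h by simp
    ultimately show "y \<in> \<phi> g ` ?O" by blast
  qed
  have "\<phi> g ` (X closure_of ?O) = X closure_of ?O" if g: "g \<in> carrier G" for g
    using homeomorphic_map_closure_of[of X X "\<phi> g" ?O] hact g img[OF g] sub
    by (simp add: action_by_homeos_def)
  moreover have "X closure_of ?O \<noteq> {}"
    using closure_of_subset[OF sub] one_closed by blast
  ultimately show ?thesis
    using minX by (simp add: minimal_action_def invariant_set_def)
qed

lemma allostericI:
  fixes G (structure) and X :: "'x topology"
  assumes cG: "countable (carrier G)" and act: "allosteric_action G X \<phi>"
  shows "allosteric G"
proof -
  have hact: "action_by_homeos G X \<phi>" and minX: "minimal_action G X \<phi>" and HX: "Hausdorff_space X"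
    using act by (auto simp: allosteric_action_def)
  interpret A: group_action G "topspace X" \<phi>
    using hact by (simp add: action_by_homeos_def)
  have grp: "group G" using A.group_hom by (simp add: group_hom_def)
  obtain x where x: "x \<in> topspace X" using minX unfolding minimal_action_def by blast
  define D where "D = (\<lambda>g. \<phi> g x) ` carrier G"
  have D: "countable D" "X closure_of D = topspace X"
    using cG minimal_action_orbit_dense[OF hact minX x] by (simp_all add: D_def)
  have hit: "\<exists>d\<in>D. d \<in> U" if "openin X U" "U \<noteq> {}" for U
    using D(2) dense_intersects_open[of X D] that by blast
  define f where "f = (\<lambda>z. (\<lambda>U. to_nat_on D ` (D \<inter> U)) ` {U. openin X U \<and> z \<in> U})"
  have inj: "inj_on f (topspace X)"
  proof (rule inj_onI, rule ccontr)
    fix y z assume yz: "y \<in> topspace X" "z \<in> topspace X" "f y = f z" "y \<noteq> z"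
    then obtain U V where UV: "openin X U" "openin X V" "y \<in> U" "z \<in> V" "disjnt U V"
      using HX unfolding Hausdorff_space_def by meson
    have "to_nat_on D ` (D \<inter> U) \<in> f z" using UV yz(3) by (auto simp: f_def)
    then obtain W where W: "openin X W" "z \<in> W" "to_nat_on D ` (D \<inter> U) = to_nat_on D ` (D \<inter> W)"
      by (auto simp: f_def)
    then have "D \<inter> U = D \<inter> W"
      using inj_on_image_eq_iff[OF inj_on_to_nat_on[OF D(1)], of "D \<inter> U" "D \<inter> W"] by blast
    moreover obtain d where "d \<in> D" "d \<in> W \<inter> V" using hit[of "W \<inter> V"] W UV by blast
    ultimately show False using UV(5) by (auto simp: disjnt_def)
  qed
  define k where "k = inv_into (topspace X) f"
  define Y where "Y = pullback_topology (f ` topspace X) k X"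
  have kf: "k (f z) = z" if "z \<in> topspace X" for z
    using inv_into_f_f[OF inj that] by (simp add: k_def)
  have tY: "topspace Y = f ` topspace X"
    using kf by (auto simp: Y_def topspace_pullback_topology)
  have "homeomorphic_maps X Y f k"
    unfolding homeomorphic_maps_def
  proof (intro conjI ballI)
    show "continuous_map X Y f"
      unfolding Y_def
    proof (rule continuous_map_pullback')
      show "continuous_map X X (k \<circ> f)"
        by (rule continuous_map_eq[OF continuous_map_id]) (simp add: kf)
      show "topspace X \<subseteq> f -` (f ` topspace X)" by blast
    qed
    show "continuous_map Y X k"
      unfolding Y_def using continuous_map_pullback[OF continuous_map_id] by (simp add: o_def)
  qed (auto simp: tY kf)
  from allosteric_action_transport[OF act this] grp show ?thesis
    unfolding allosteric_def by blast
qed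

end

theory Submission
  imports Defs
begin

text \<open>
  If all quotients by finite normal subgroups are allosteric, then so is the quotient by the trivial
  subgroup, which is isomorphic to \<open>G\<close>; an action of it on a space pulls back to an action of
  \<open>G\<close> on the same space with the same invariant sets and corresponding stabilizers
  (\<open>allosteric_action_pullback_iso\<close>).

  Conversely, let \<open>G\<close> act on \<open>X\<close> allosterically and let \<open>H\<close> be a finite normal subgroup. Then
  \<open>G Mod H\<close> acts on the space \<open>X/H\<close> of \<open>H\<close>-orbits. Because \<open>H\<close> is finite, \<open>X/H\<close> is again compact
  Hausdorff, and compactness, minimality, invariance and ergodicity of the image measure pass to it
  along the projection. The one thing that could go wrong is that the failure of essential freeness
  on \<open>X\<close> is caused by \<open>H\<close> alone and so disappears in \<open>X/H\<close>. It is not, because \<open>H\<close> acts freely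
  everywhere (\<open>finite_normal_acts_freely\<close>): the points fixed by some nontrivial element of \<open>H\<close> form
  a closed \<open>G\<close>-invariant set, which by minimality is empty or all of \<open>X\<close>, and the latter is
  impossible since by the Baire category theorem some point has trivial stabilizer. The stabilizer
  of the orbit \<open>H x\<close> consists of the cosets of elements stabilizing \<open>x\<close>, so it is now trivial
  exactly when the stabilizer of \<open>x\<close> is (\<open>stabilizer_quotient_trivial_iff\<close>). Both topological
  freeness and the failure of essential freeness therefore descend to \<open>X/H\<close>.
\<close>

section \<open>Pulling actions back along isomorphisms\<close>

lemma allosteric_action_pullback_iso:
  fixes G :: "('g, 'm) monoid_scheme" and K :: "('k, 'n) monoid_scheme"
  assumes G: "group G" and iso: "\<theta> \<in> iso G K" and act: "allosteric_action K X \<phi>"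
  shows "allosteric_action G X (\<lambda>g. \<phi> (\<theta> g))"
proof -
  interpret A: group_action K "topspace X" \<phi>
    using act by (simp add: allosteric_action_def action_by_homeos_def)
  have K: "group K" using A.group_hom by (simp add: group_hom_def)
  have hom: "\<theta> \<in> hom G K" and img: "\<theta> ` carrier G = carrier K" and inj: "inj_on \<theta> (carrier G)"
    using iso by (auto simp: iso_def bij_betw_def)
  have one: "\<theta> \<one>\<^bsub>G\<^esub> = \<one>\<^bsub>K\<^esub>" using hom_one[OF hom G K] .
  have act': "group_action G (topspace X) (\<lambda>g. \<phi> (\<theta> g))"
    using Group.hom_compose[OF hom, of \<phi> "BijGroup (topspace X)"] A.group_hom G
    by (simp add: group_action_def group_hom_def group_hom_axioms_def o_def)
  have inv: "invariant_set G (\<lambda>g. \<phi> (\<theta> g)) = invariant_set K \<phi>"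
    by (auto simp: invariant_set_def fun_eq_iff img[symmetric])
  have stab: "stabilizer G (\<lambda>g. \<phi> (\<theta> g)) x = {\<one>\<^bsub>G\<^esub>} \<longleftrightarrow> stabilizer K \<phi> x = {\<one>\<^bsub>K\<^esub>}" for x
  proof -
    have st: "stabilizer K \<phi> x = \<theta> ` stabilizer G (\<lambda>g. \<phi> (\<theta> g)) x"
      by (auto simp: stabilizer_def img[symmetric])
    have "{\<one>\<^bsub>K\<^esub>} = \<theta> ` {\<one>\<^bsub>G\<^esub>}" using one by simp
    moreover have "stabilizer G (\<lambda>g. \<phi> (\<theta> g)) x \<subseteq> carrier G" by (auto simp: stabilizer_def)
    moreover have "{\<one>\<^bsub>G\<^esub>} \<subseteq> carrier G" using G by (simp add: group.is_monoid)
    ultimately show ?thesis using st inj_on_image_eq_iff[OF inj] by metis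
  qed
  have erg: "ergodic_measure G X (\<lambda>g. \<phi> (\<theta> g)) M \<longleftrightarrow> ergodic_measure K X \<phi> M" for M
    by (simp add: ergodic_measure_def inv img[symmetric])
  show ?thesis
    using act act'
    by (auto simp: allosteric_action_def action_by_homeos_def minimal_action_def
        topologically_free_def essentially_free_def inv stab erg img[symmetric])
qed

lemma iso_factor_trivial_subgroup:
  assumes "group G"
  shows "(\<lambda>g. {\<one>\<^bsub>G\<^esub>} #>\<^bsub>G\<^esub> g) \<in> iso G (G Mod {\<one>\<^bsub>G\<^esub>})"
proof -
  interpret normal "{\<one>\<^bsub>G\<^esub>}" G using assms by (rule group.one_is_normal)
  have coset: "{\<one>\<^bsub>G\<^esub>} #>\<^bsub>G\<^esub> g = {g}" if "g \<in> carrier G" for g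
    using that by (simp add: r_coset_def)
  show ?thesis
    using r_coset_hom_Mod
    by (auto simp: iso_def bij_betw_def inj_on_def carrier_FactGroup coset)
qed

section \<open>The quotient of an action by a finite normal subgroup\<close>

locale finite_normal_action =
  normal H G + group_action G "topspace X" \<phi>
  for H and G :: "('g, 'm) monoid_scheme" (structure) and X :: "'x topology" and \<phi> +
  assumes finite_H: "finite H"
    and homeo: "g \<in> carrier G \<Longrightarrow> homeomorphic_map X X (\<phi> g)"
    and compact: "compact_space X"
    and Hausdorff: "Hausdorff_space X"
begin

lemma H_nonempty: "H \<noteq> {}"
  using is_subgroup subgroup_nonempty by blast

lemma action_closed: "g \<in> carrier G \<Longrightarrow> x \<in> topspace X \<Longrightarrow> \<phi> g x \<in> topspace X"
  by (rule element_image[OF _ _ refl])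

lemma action_one: "x \<in> topspace X \<Longrightarrow> \<phi> \<one> x = x"
  by (metis id_eq_one restrict_apply')

lemma action_inv: "g \<in> carrier G \<Longrightarrow> x \<in> topspace X \<Longrightarrow> \<phi> g (\<phi> (inv g) x) = x"
  using composition_rule[of x g "inv g"] by (simp add: action_one)

lemma action_continuous: "g \<in> carrier G \<Longrightarrow> continuous_map X X (\<phi> g)"
  by (simp add: homeo homeomorphic_imp_continuous_map)

definition orb :: "'x \<Rightarrow> 'x set" where
  "orb x = (\<lambda>h. \<phi> h x) ` H"

lemma orb_subset: "x \<in> topspace X \<Longrightarrow> orb x \<subseteq> topspace X"
  by (auto simp: orb_def action_closed)

lemma orb_refl: "x \<in> topspace X \<Longrightarrow> x \<in> orb x"
  unfolding orb_def by (rule image_eqI[where x = \<one>]) (simp_all add: action_one)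

text \<open>Normality of \<open>H\<close> gives \<open>(H g)(H x) = H (g x)\<close>, which is what lets cosets act on
  \<open>H\<close>-orbits.\<close>

lemma coset_orb:
  assumes g: "g \<in> carrier G" and x: "x \<in> topspace X"
  shows "(\<Union>k\<in>H #> g. \<phi> k ` orb x) = orb (\<phi> g x)"
proof (intro equalityI subsetI)
  fix y assume "y \<in> (\<Union>k\<in>H #> g. \<phi> k ` orb x)"
  then obtain h h' where h: "h \<in> H" "h' \<in> H" and y: "y = \<phi> (h \<otimes> g) (\<phi> h' x)"
    by (auto simp: r_coset_def orb_def)
  have "h \<otimes> g \<otimes> h' = (h \<otimes> (g \<otimes> h' \<otimes> inv g)) \<otimes> g"
    using h g by (simp add: m_assoc)
  moreover have "g \<otimes> h' \<otimes> inv g \<in> H" using g h by (simp add: inv_op_closed2)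
  ultimately have "y = \<phi> (h \<otimes> (g \<otimes> h' \<otimes> inv g)) (\<phi> g x)"
    unfolding y using g h x
    by (metis composition_rule m_closed mem_carrier)
  then show "y \<in> orb (\<phi> g x)"
    using h \<open>g \<otimes> h' \<otimes> inv g \<in> H\<close> by (auto simp: orb_def)
next
  fix y assume "y \<in> orb (\<phi> g x)"
  then obtain h where h: "h \<in> H" "y = \<phi> (h \<otimes> g) x"
    using g x by (auto simp: orb_def composition_rule)
  then have "y \<in> \<phi> (h \<otimes> g) ` orb x" using orb_refl[OF x] by blast
  moreover have "h \<otimes> g \<in> H #> g" using h(1) by (auto simp: r_coset_def)
  ultimately show "y \<in> (\<Union>k\<in>H #> g. \<phi> k ` orb x)" by blast
qed

lemma orb_translate:
  assumes h: "h \<in> H" and x: "x \<in> topspace X"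
  shows "orb (\<phi> h x) = orb x"
  using coset_orb[of h x] coset_orb[of \<one> x] assms coset_join2[of h] coset_join2[of \<one>]
  by (simp add: action_one is_subgroup)

lemma orb_eq_iff:
  assumes x: "x \<in> topspace X" and y: "y \<in> topspace X"
  shows "orb x = orb y \<longleftrightarrow> y \<in> orb x"
  using orb_refl[OF y] orb_translate[OF _ x] by (auto simp: orb_def[of x])

definition quotient_space :: "'x set topology" where
  "quotient_space =
     topology (\<lambda>V. V \<subseteq> orb ` topspace X \<and> openin X {x \<in> topspace X. orb x \<in> V})"

lemma openin_quotient:
  "openin quotient_space V \<longleftrightarrow>
     V \<subseteq> orb ` topspace X \<and> openin X {x \<in> topspace X. orb x \<in> V}"
proof -
  have "istopology (\<lambda>V. V \<subseteq> orb ` topspace X \<and> openin X {x \<in> topspace X. orb x \<in> V})"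
    unfolding istopology_def
  proof (intro conjI allI impI)
    fix S T
    assume S: "S \<subseteq> orb ` topspace X \<and> openin X {x \<in> topspace X. orb x \<in> S}"
      and T: "T \<subseteq> orb ` topspace X \<and> openin X {x \<in> topspace X. orb x \<in> T}"
    show "S \<inter> T \<subseteq> orb ` topspace X" using S by blast
    have "{x \<in> topspace X. orb x \<in> S \<inter> T} =
        {x \<in> topspace X. orb x \<in> S} \<inter> {x \<in> topspace X. orb x \<in> T}" by blast
    then show "openin X {x \<in> topspace X. orb x \<in> S \<inter> T}" using S T by (simp add: openin_Int)
  next
    fix \<K> assume K: "\<forall>V\<in>\<K>. V \<subseteq> orb ` topspace X \<and> openin X {x \<in> topspace X. orb x \<in> V}"
    show "\<Union>\<K> \<subseteq> orb ` topspace X" using K by blast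
    have "{x \<in> topspace X. orb x \<in> \<Union>\<K>} = (\<Union>V\<in>\<K>. {x \<in> topspace X. orb x \<in> V})" by blast
    then show "openin X {x \<in> topspace X. orb x \<in> \<Union>\<K>}" using K by auto
  qed
  then show ?thesis by (simp add: quotient_space_def)
qed

lemma topspace_quotient [simp]: "topspace quotient_space = orb ` topspace X"
proof (rule antisym)
  show "topspace quotient_space \<subseteq> orb ` topspace X"
    using openin_topspace[of quotient_space] openin_quotient by blast
  have "{x \<in> topspace X. orb x \<in> orb ` topspace X} = topspace X" by blast
  then have "openin quotient_space (orb ` topspace X)" by (simp add: openin_quotient)
  then show "orb ` topspace X \<subseteq> topspace quotient_space" by (rule openin_subset)
qed

lemma quotient_map_orb: "quotient_map X quotient_space orb"
  by (simp add: quotient_map_def openin_quotient)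

lemma continuous_orb: "continuous_map X quotient_space orb"
  by (rule quotient_imp_continuous_map[OF quotient_map_orb])

text \<open>The largest \<open>H\<close>-invariant subset of \<open>U\<close>. Images of open sets need not separate orbits that
  the sets themselves separate; the images of invariant cores do. As \<open>H\<close> is finite, the core is
  a finite intersection of translates of \<open>U\<close>, so it is open if \<open>U\<close> is, and dense if \<open>U\<close> is open
  and dense.\<close>

definition invariant_core :: "'x set \<Rightarrow> 'x set" where
  "invariant_core U = {x \<in> topspace X. orb x \<subseteq> U}"

lemma invariant_core_subset: "invariant_core U \<subseteq> U"
  using orb_refl by (auto simp: invariant_core_def)

lemma invariant_core_eq_INT: "invariant_core U = (\<Inter>h\<in>H. {x \<in> topspace X. \<phi> h x \<in> U})"
  using H_nonempty action_closed by (auto simp: invariant_core_def orb_def)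

lemma openin_invariant_core:
  assumes "openin X U"
  shows "openin X (invariant_core U)"
  unfolding invariant_core_eq_INT
proof (rule openin_INT2)
  show "finite H" "H \<noteq> {}" using finite_H H_nonempty by blast+
  show "openin X {x \<in> topspace X. \<phi> h x \<in> U}" if "h \<in> H" for h
    using openin_continuous_map_preimage[OF action_continuous assms] that by simp
qed

lemma openin_image_invariant_core:
  assumes "openin X U"
  shows "openin quotient_space (orb ` invariant_core U)"
proof -
  have "{x \<in> topspace X. orb x \<in> orb ` invariant_core U} = invariant_core U"
    by (auto simp: invariant_core_def)
  then show ?thesis
    using openin_invariant_core[OF assms] by (auto simp: openin_quotient invariant_core_def)
qed

lemma compact_quotient: "compact_space quotient_space"
  using image_compactin[OF _ continuous_orb, of "topspace X"] compact
  by (simp add: compact_space_def)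

text \<open>Distinct orbits are disjoint finite sets, so disjoint open sets separate them in \<open>X\<close>; the
  images of their invariant cores remain disjoint.\<close>

lemma Hausdorff_quotient: "Hausdorff_space quotient_space"
  unfolding Hausdorff_space_def
proof (intro allI impI)
  fix y z
  assume "y \<in> topspace quotient_space \<and> z \<in> topspace quotient_space \<and> y \<noteq> z"
  then obtain a b where a: "a \<in> topspace X" "y = orb a" and b: "b \<in> topspace X" "z = orb b"
    and ne: "orb a \<noteq> orb b" by auto
  have fin: "finite (orb a)" "finite (orb b)" using finite_H by (simp_all add: orb_def)
  have "disjnt (orb a) (orb b)"
    unfolding disjnt_iff
    using ne orb_eq_iff a(1) b(1) orb_subset by (metis subsetD)
  with fin obtain U V where UV: "openin X U" "openin X V" "orb a \<subseteq> U" "orb b \<subseteq> V" "disjnt U V"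
    using Hausdorff_space_compact_sets[of X] Hausdorff orb_subset[OF a(1)] orb_subset[OF b(1)]
      finite_imp_compactin by meson
  have "disjnt (orb ` invariant_core U) (orb ` invariant_core V)"
  proof -
    have False if "p \<in> invariant_core U" "q \<in> invariant_core V" "orb p = orb q" for p q
      using that UV(5) orb_refl[of p] by (auto simp: invariant_core_def disjnt_iff)
    then show ?thesis by (auto simp: disjnt_iff)
  qed
  moreover have "y \<in> orb ` invariant_core U" "z \<in> orb ` invariant_core V"
    using a b UV by (auto simp: invariant_core_def)
  ultimately show "\<exists>U V. openin quotient_space U \<and> openin quotient_space V \<and> y \<in> U \<and> z \<in> V \<and> disjnt U V"
    using openin_image_invariant_core UV(1,2) by blast
qed

lemma dense_countable_Inter:
  assumes "countable \<U>" "\<And>U. U \<in> \<U> \<Longrightarrow> openin X U \<and> X closure_of U = topspace X"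
  shows "X closure_of \<Inter>\<U> = topspace X"
  using Baire_category[OF _ assms] compact Hausdorff compact_imp_locally_compact_space
    compact_Hausdorff_or_regular_imp_normal_space compact_Hausdorff_imp_regular_space by blast

lemma dense_invariant_core:
  assumes U: "openin X U" "X closure_of U = topspace X"
  shows "X closure_of (invariant_core U) = topspace X"
  unfolding invariant_core_eq_INT
proof (rule dense_countable_Inter)
  show "countable ((\<lambda>h. {x \<in> topspace X. \<phi> h x \<in> U}) ` H)"
    using finite_H by (simp add: countable_finite)
  fix V assume "V \<in> (\<lambda>h. {x \<in> topspace X. \<phi> h x \<in> U}) ` H"
  then obtain h where h: "h \<in> H" and V: "V = {x \<in> topspace X. \<phi> h x \<in> U}" by blast
  have "V = \<phi> (inv h) ` U"
  proof (intro equalityI subsetI)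
    fix x assume "x \<in> V"
    then show "x \<in> \<phi> (inv h) ` U"
      using h orbit_sym_aux[of h x "\<phi> h x"] by (intro image_eqI[where x = "\<phi> h x"]) (auto simp: V)
  next
    fix x assume "x \<in> \<phi> (inv h) ` U"
    then show "x \<in> V"
      using h openin_subset[OF U(1)] by (auto simp: V action_inv action_closed)
  qed
  moreover have "X closure_of (\<phi> (inv h) ` U) = topspace X"
    using homeomorphic_map_closure_of[OF homeo[of "inv h"], of U] openin_subset[OF U(1)]
      surj_prop[of "inv h"] h U(2) by simp
  ultimately show "openin X V \<and> X closure_of V = topspace X"
    using openin_continuous_map_preimage[OF action_continuous U(1), of h] h V by simp
qed

text \<open>The orbit \<open>y\<close> is sent to the product set \<open>C y\<close>, so no representatives have to be chosen. The
  restriction makes the map extensional, as membership in \<open>Bij\<close> requires.\<close>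

definition quotient_action :: "'g set \<Rightarrow> 'x set \<Rightarrow> 'x set" where
  "quotient_action C = (\<lambda>y\<in>topspace quotient_space. \<Union>k\<in>C. \<phi> k ` y)"

lemma quotient_action_orb:
  "g \<in> carrier G \<Longrightarrow> x \<in> topspace X \<Longrightarrow> quotient_action (H #> g) (orb x) = orb (\<phi> g x)"
  by (simp add: quotient_action_def coset_orb)

lemma homeomorphic_maps_quotient_action:
  assumes g: "g \<in> carrier G"
  shows "homeomorphic_maps quotient_space quotient_space
           (quotient_action (H #> g)) (quotient_action (H #> inv g))"
proof -
  have cont: "continuous_map quotient_space quotient_space (quotient_action (H #> k))"
    if k: "k \<in> carrier G" for k
  proof (rule continuous_compose_quotient_map[OF quotient_map_orb])
    have "continuous_map X quotient_space (orb \<circ> \<phi> k)"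
      using continuous_map_compose[OF action_continuous[OF k] continuous_orb] .
    then show "continuous_map X quotient_space (quotient_action (H #> k) \<circ> orb)"
      by (rule continuous_map_eq) (simp add: quotient_action_orb k)
  qed
  show ?thesis
    using g cont action_inv[of g] action_inv[of "inv g"]
    by (auto simp: homeomorphic_maps_def quotient_action_orb action_closed)
qed

lemma homeomorphic_map_quotient_action:
  "g \<in> carrier G \<Longrightarrow> homeomorphic_map quotient_space quotient_space (quotient_action (H #> g))"
  using homeomorphic_maps_quotient_action homeomorphic_map_maps by blast

lemma action_by_homeos_quotient: "action_by_homeos (G Mod H) quotient_space quotient_action"
proof -
  have Bij: "quotient_action C \<in> Bij (topspace quotient_space)" if "C \<in> carrier (G Mod H)" for C
  proof -
    from that obtain g where "g \<in> carrier G" "C = H #> g" by (auto simp: carrier_FactGroup)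
    then show ?thesis
      using homeomorphic_imp_surjective_map[OF homeomorphic_map_quotient_action[of g]]
        homeomorphic_imp_injective_map[OF homeomorphic_map_quotient_action[of g]]
      unfolding Bij_def bij_betw_def
      by (simp del: topspace_quotient) (simp add: quotient_action_def)
  qed
  have "group_action (G Mod H) (topspace quotient_space) quotient_action"
  proof (intro group_action.intro group_hom.intro group_hom_axioms.intro
      factorgroup_is_group group_BijGroup homI)
    fix C assume "C \<in> carrier (G Mod H)"
    then show "quotient_action C \<in> carrier (BijGroup (topspace quotient_space))"
      using Bij by (simp add: BijGroup_def)
  next
    fix C D assume CD: "C \<in> carrier (G Mod H)" "D \<in> carrier (G Mod H)"
    then obtain g k where g: "g \<in> carrier G" "C = H #> g" and k: "k \<in> carrier G" "D = H #> k"
      by (auto simp: carrier_FactGroup)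
    have "quotient_action (H #> (g \<otimes> k)) =
        compose (topspace quotient_space) (quotient_action C) (quotient_action D)"
    proof
      fix y
      show "quotient_action (H #> (g \<otimes> k)) y =
          compose (topspace quotient_space) (quotient_action C) (quotient_action D) y"
      proof (cases "y \<in> topspace quotient_space")
        case True
        then obtain x where "x \<in> topspace X" "y = orb x" by auto
        then show ?thesis
          using g k by (simp add: compose_def quotient_action_orb composition_rule action_closed)
      qed (simp add: compose_def quotient_action_def)
    qed
    then show "quotient_action (C \<otimes>\<^bsub>G Mod H\<^esub> D) =
        quotient_action C \<otimes>\<^bsub>BijGroup (topspace quotient_space)\<^esub> quotient_action D"
      using Bij CD g k by (simp add: BijGroup_def rcos_sum)
  qed
  then show ?thesis
    using homeomorphic_map_quotient_action
    by (auto simp: action_by_homeos_def carrier_FactGroup)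
qed

definition orb_preimage :: "'x set set \<Rightarrow> 'x set" where
  "orb_preimage B = {x \<in> topspace X. orb x \<in> B}"

lemma orb_preimage_quotient_action:
  assumes g: "g \<in> carrier G" and B: "B \<subseteq> topspace quotient_space"
  shows "orb_preimage (quotient_action (H #> g) ` B) = \<phi> g ` orb_preimage B"
proof (intro equalityI subsetI)
  fix x assume "x \<in> \<phi> g ` orb_preimage B"
  then show "x \<in> orb_preimage (quotient_action (H #> g) ` B)"
    using g by (auto simp: orb_preimage_def action_closed quotient_action_orb[symmetric])
next
  fix x assume "x \<in> orb_preimage (quotient_action (H #> g) ` B)"
  then obtain b where x: "x \<in> topspace X" and b: "b \<in> B" "orb x = quotient_action (H #> g) b"
    by (auto simp: orb_preimage_def)
  then have "quotient_action (H #> inv g) (orb x) = b"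
    using homeomorphic_maps_quotient_action[OF g] B by (auto simp: homeomorphic_maps_def)
  then have "orb (\<phi> (inv g) x) = b" using g x by (simp add: quotient_action_orb)
  then have "\<phi> (inv g) x \<in> orb_preimage B" using b g x by (simp add: orb_preimage_def action_closed)
  then show "x \<in> \<phi> g ` orb_preimage B" using action_inv[OF g x] by (metis image_eqI)
qed

lemma invariant_orb_preimage:
  assumes "invariant_set (G Mod H) quotient_action B" "B \<subseteq> topspace quotient_space"
  shows "invariant_set G \<phi> (orb_preimage B)"
  unfolding invariant_set_def
proof
  fix g assume g: "g \<in> carrier G"
  then have "quotient_action (H #> g) ` B = B"
    using assms(1) by (auto simp: invariant_set_def carrier_FactGroup)
  then show "\<phi> g ` orb_preimage B = orb_preimage B" using orb_preimage_quotient_action[OF g assms(2)] by simp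
qed

lemma minimal_quotient:
  assumes min: "minimal_action G X \<phi>"
  shows "minimal_action (G Mod H) quotient_space quotient_action"
  unfolding minimal_action_def
proof (intro conjI allI impI)
  show "topspace quotient_space \<noteq> {}" using min by (simp add: minimal_action_def)
  fix C assume C: "closedin quotient_space C \<and> invariant_set (G Mod H) quotient_action C \<and> C \<noteq> {}"
  then have sub: "C \<subseteq> orb ` topspace X" using closedin_subset by fastforce
  have "closedin X (orb_preimage C)"
    unfolding orb_preimage_def using C closedin_continuous_map_preimage[OF continuous_orb] by blast
  moreover have "invariant_set G \<phi> (orb_preimage C)" using C sub by (simp add: invariant_orb_preimage)
  moreover have "orb_preimage C \<noteq> {}" using C sub by (auto simp: orb_preimage_def)
  ultimately have "orb_preimage C = topspace X" using min by (simp add: minimal_action_def)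
  then show "C = topspace quotient_space" using sub by (auto simp: orb_preimage_def)
qed

section \<open>Freeness of the finite subgroup and of the quotient action\<close>

text \<open>The points with nontrivial \<open>H\<close>-stabilizer form a closed set because \<open>H\<close> is finite, and an
  invariant one because \<open>H\<close> is normal. Minimality leaves only the empty set and \<open>X\<close>, and
  topological freeness rules out \<open>X\<close>: a residual set in a nonempty compact Hausdorff space is
  nonempty.\<close>

lemma finite_normal_acts_freely:
  assumes min: "minimal_action G X \<phi>" and free: "topologically_free G X \<phi>"
    and x: "x \<in> topspace X" and h: "h \<in> H" and fixed: "\<phi> h x = x"
  shows "h = \<one>"
proof (rule ccontr)
  assume "h \<noteq> \<one>"
  define F where "F = (\<Union>k\<in>H - {\<one>}. {y \<in> topspace X. \<phi> k y = y})"
  have "closedin X F"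
    unfolding F_def
  proof (intro closedin_Union)
    show "finite ((\<lambda>k. {y \<in> topspace X. \<phi> k y = y}) ` (H - {\<one>}))" using finite_H by simp
    fix S assume "S \<in> (\<lambda>k. {y \<in> topspace X. \<phi> k y = y}) ` (H - {\<one>})"
    then obtain k where "k \<in> H" "S = {y \<in> topspace X. \<phi> k y = y}" by blast
    then show "closedin X S"
      using closedin_continuous_maps_eq[OF Hausdorff action_continuous[of k] continuous_map_id] by simp
  qed
  moreover have "invariant_set G \<phi> F"
  proof -
    have sub: "\<phi> g y \<in> F" if g: "g \<in> carrier G" and y: "y \<in> F" for g y
    proof -
      from y obtain k where k: "k \<in> H" "k \<noteq> \<one>" and yX: "y \<in> topspace X" and fy: "\<phi> k y = y"
        by (auto simp: F_def)
      \<comment> \<open>If \<open>k\<close> fixes \<open>y\<close>, then its conjugate by \<open>g\<close> fixes \<open>\<phi> g y\<close>.\<close>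
      let ?c = "g \<otimes> k \<otimes> inv g"
      have c: "?c \<in> H" using g k by (simp add: inv_op_closed2)
      have "?c \<noteq> \<one>"
      proof
        assume "?c = \<one>"
        then have "g \<otimes> k = g" using g k by (metis inv_closed inv_equality inv_inv m_closed mem_carrier)
        then show False using g k by simp
      qed
      moreover have "?c \<otimes> g = g \<otimes> k" using g k by (simp add: m_assoc)
      then have "\<phi> ?c (\<phi> g y) = \<phi> g y"
        using g k yX fy composition_rule[OF yX, of ?c g] composition_rule[OF yX, of g k] by simp
      ultimately show ?thesis using c g yX by (auto simp: F_def action_closed)
    qed
    have "y \<in> \<phi> g ` F" if g: "g \<in> carrier G" and y: "y \<in> F" for g y
    proof -
      have "\<phi> g (\<phi> (inv g) y) = y" using action_inv g y by (auto simp: F_def)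
      then show ?thesis using sub[of "inv g" y] g y by (metis image_eqI inv_closed)
    qed
    with sub show ?thesis by (auto simp: invariant_set_def)
  qed
  moreover have "x \<in> F" using x h fixed \<open>h \<noteq> \<one>\<close> by (auto simp: F_def)
  ultimately have F: "F = topspace X" using min by (auto simp: minimal_action_def)
  from free obtain \<U> where \<U>: "countable \<U>"
    "\<And>U. U \<in> \<U> \<Longrightarrow> openin X U \<and> X closure_of U = topspace X"
    "topspace X \<inter> \<Inter>\<U> \<subseteq> {x \<in> topspace X. stabilizer G \<phi> x = {\<one>}}"
    unfolding topologically_free_def residual_in_def by blast
  have "X closure_of \<Inter>\<U> = topspace X" using \<U>(1,2) by (rule dense_countable_Inter)
  then have "topspace X \<inter> \<Inter>\<U> \<noteq> {}"
    using x closure_of_restrict[of X "\<Inter>\<U>"] by auto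
  then obtain z where z: "z \<in> topspace X" "stabilizer G \<phi> z = {\<one>}" using \<U>(3) by blast
  with F obtain k where "k \<in> H" "k \<noteq> \<one>" "\<phi> k z = z" by (auto simp: F_def)
  then have "k \<in> stabilizer G \<phi> z" by (simp add: stabilizer_def)
  with z \<open>k \<noteq> \<one>\<close> show False by simp
qed

text \<open>An element stabilizing \<open>x\<close> gives a coset stabilizing the orbit of \<open>x\<close>, and that coset is
  trivial only if the element lies in \<open>H\<close>, hence, by freeness of \<open>H\<close>, only if it is \<open>\<one>\<close>.
  Conversely, if \<open>H g\<close> stabilizes the orbit, then some \<open>h g\<close> with \<open>h\<close> in \<open>H\<close> stabilizes \<open>x\<close>.\<close>

lemma stabilizer_quotient_trivial_iff:
  assumes min: "minimal_action G X \<phi>" and free: "topologically_free G X \<phi>"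
    and x: "x \<in> topspace X"
  shows "stabilizer (G Mod H) quotient_action (orb x) = {\<one>\<^bsub>G Mod H\<^esub>} \<longleftrightarrow> stabilizer G \<phi> x = {\<one>}"
proof
  assume L: "stabilizer (G Mod H) quotient_action (orb x) = {\<one>\<^bsub>G Mod H\<^esub>}"
  have "g = \<one>" if "g \<in> stabilizer G \<phi> x" for g
  proof -
    have g: "g \<in> carrier G" "\<phi> g x = x" using that by (auto simp: stabilizer_def)
    then have "H #> g \<in> stabilizer (G Mod H) quotient_action (orb x)"
      using x by (auto simp: stabilizer_def carrier_FactGroup quotient_action_orb)
    then have "H #> g = H" using L by simp
    then have "g \<in> H" using g coset_join1 is_subgroup by blast
    then show ?thesis using finite_normal_acts_freely[OF min free x] g by blast
  qed
  moreover have "\<one> \<in> stabilizer G \<phi> x" using x by (simp add: stabilizer_def action_one)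
  ultimately show "stabilizer G \<phi> x = {\<one>}" by blast
next
  assume R: "stabilizer G \<phi> x = {\<one>}"
  have "C = H" if "C \<in> stabilizer (G Mod H) quotient_action (orb x)" for C
  proof -
    from that obtain g where g: "g \<in> carrier G" "C = H #> g" and "orb (\<phi> g x) = orb x"
      using x by (auto simp: stabilizer_def carrier_FactGroup quotient_action_orb)
    then have "x \<in> orb (\<phi> g x)" using orb_refl[OF x] by simp
    then obtain h where h: "h \<in> H" "\<phi> (h \<otimes> g) x = x"
      using g x by (auto simp: orb_def composition_rule)
    then have "h \<otimes> g \<in> stabilizer G \<phi> x" using g by (simp add: stabilizer_def)
    then have "h \<otimes> g = \<one>" using R by blast
    then have "inv g = h" using g h by (intro inv_equality) auto
    then have "inv h = g" using g by auto
    then have "g \<in> H" using h(1) m_inv_closed by blast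
    then show ?thesis using g coset_join2 is_subgroup by simp
  qed
  moreover have "H \<in> stabilizer (G Mod H) quotient_action (orb x)"
    using x quotient_action_orb[of \<one> x] coset_join2[of \<one>] is_subgroup
    by (auto simp: stabilizer_def carrier_FactGroup action_one intro: image_eqI[where x = \<one>])
  ultimately show "stabilizer (G Mod H) quotient_action (orb x) = {\<one>\<^bsub>G Mod H\<^esub>}" by auto
qed

text \<open>Projecting a countable family of dense open sets could enlarge its intersection. Passing to
  invariant cores first prevents this: if the orbit of \<open>x\<close> lies in the image of the core of \<open>U\<close>,
  then \<open>x\<close> itself lies in \<open>U\<close>.\<close>

lemma topologically_free_quotient:
  assumes min: "minimal_action G X \<phi>" and free: "topologically_free G X \<phi>"
  shows "topologically_free (G Mod H) quotient_space quotient_action"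
proof -
  let ?S = "{x \<in> topspace X. stabilizer G \<phi> x = {\<one>}}"
  let ?T = "{y \<in> topspace quotient_space. stabilizer (G Mod H) quotient_action y = {\<one>\<^bsub>G Mod H\<^esub>}}"
  from free obtain \<U> where \<U>: "countable \<U>"
    "\<And>U. U \<in> \<U> \<Longrightarrow> openin X U \<and> X closure_of U = topspace X"
    "topspace X \<inter> \<Inter>\<U> \<subseteq> ?S"
    unfolding topologically_free_def residual_in_def by blast
  let ?V = "(\<lambda>U. orb ` invariant_core U) ` \<U>"
  have "openin quotient_space V \<and> quotient_space closure_of V = topspace quotient_space"
    if "V \<in> ?V" for V
  proof -
    from that obtain U where U: "U \<in> \<U>" "V = orb ` invariant_core U" by blast
    have "X closure_of invariant_core U = topspace X" using dense_invariant_core \<U>(2)[OF U(1)] by blast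
    then have "orb ` topspace X \<subseteq> quotient_space closure_of V"
      using continuous_map_image_closure_subset[OF continuous_orb, of "invariant_core U"] U(2) by simp
    then show ?thesis
      using openin_image_invariant_core \<U>(2)[OF U(1)] U(2) closure_of_subset_topspace[of quotient_space V]
      by auto
  qed
  moreover have "topspace quotient_space \<inter> \<Inter>?V \<subseteq> ?T"
  proof
    fix y assume y: "y \<in> topspace quotient_space \<inter> \<Inter>?V"
    then obtain x where x: "x \<in> topspace X" "y = orb x" by auto
    have "x \<in> U" if "U \<in> \<U>" for U
    proof -
      from y that obtain u where "u \<in> invariant_core U" "orb x = orb u" using x by auto
      then have "x \<in> invariant_core U" using x by (simp add: invariant_core_def)
      then show ?thesis using invariant_core_subset by blast
    qed
    then have "x \<in> ?S" using \<U>(3) x by blast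
    then show "y \<in> ?T" using stabilizer_quotient_trivial_iff[OF min free x(1)] x by simp
  qed
  moreover have "countable ?V" using \<U>(1) by simp
  ultimately show ?thesis unfolding topologically_free_def residual_in_def by blast
qed

section \<open>Pushing the measure forward\<close>

lemma sets_quotient_action_image:
  assumes g: "g \<in> carrier G" and B: "B \<in> sets (borel_sigma quotient_space)"
  shows "quotient_action (H #> g) ` B \<in> sets (borel_sigma quotient_space)"
proof -
  let ?p = "quotient_action (H #> g)" and ?q = "quotient_action (H #> inv g)"
  have pq: "homeomorphic_maps quotient_space quotient_space ?p ?q"
    using g by (rule homeomorphic_maps_quotient_action)
  have sub: "B \<subseteq> topspace quotient_space" using sets.sets_into_space[OF B] by simp
  have "?q \<in> measurable (borel_sigma quotient_space) (borel_sigma quotient_space)"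
    using pq by (simp add: measurable_borel_sigma homeomorphic_maps_def)
  then have "?q -` B \<inter> topspace quotient_space \<in> sets (borel_sigma quotient_space)"
    using measurable_sets[OF _ B] space_borel_sigma by metis
  moreover have "?q -` B \<inter> topspace quotient_space = ?p ` B"
  proof (intro equalityI subsetI)
    fix y assume "y \<in> ?q -` B \<inter> topspace quotient_space"
    then have "?q y \<in> B" "y = ?p (?q y)" using pq by (auto simp: homeomorphic_maps_def)
    then show "y \<in> ?p ` B" by blast
  next
    fix y assume "y \<in> ?p ` B"
    then obtain b where b: "b \<in> B" "y = ?p b" by blast
    then have "b \<in> topspace quotient_space" using sub by blast
    then have "?q y = b" "y \<in> topspace quotient_space"
      using pq b continuous_map_image_subset_topspace[of quotient_space quotient_space ?p]
      unfolding homeomorphic_maps_def by blast+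
    then show "y \<in> ?q -` B \<inter> topspace quotient_space" using b by simp
  qed
  ultimately show ?thesis by simp
qed

text \<open>The measure on \<open>X/H\<close> is the image of the ergodic measure on \<open>X\<close>. Preimages under the
  projection commute with the actions, which carries invariance and ergodicity over, and a null set
  containing all orbits with nontrivial stabilizer pulls back to one containing all points with
  nontrivial stabilizer.\<close>

lemma allosteric_action_quotient:
  assumes act: "allosteric_action G X \<phi>"
  shows "allosteric_action (G Mod H) quotient_space quotient_action"
proof -
  from act obtain M where min: "minimal_action G X \<phi>" and free: "topologically_free G X \<phi>"
    and erg: "ergodic_measure G X \<phi> M" and nef: "\<not> essentially_free G \<phi> M"
    unfolding allosteric_action_def by blast
  have psM: "prob_space M" and setsM: "sets M = sets (borel_sigma X)"
    and invM: "\<And>g A. g \<in> carrier G \<Longrightarrow> A \<in> sets M \<Longrightarrow> measure M (\<phi> g ` A) = measure M A"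
    and ergM: "\<And>A. A \<in> sets M \<Longrightarrow> invariant_set G \<phi> A \<Longrightarrow> measure M A = 0 \<or> measure M A = 1"
    using erg unfolding ergodic_measure_def by blast+
  have spM: "space M = topspace X" using sets_eq_imp_space_eq[OF setsM] by simp
  have meas: "orb \<in> measurable M (borel_sigma quotient_space)"
    using measurable_borel_sigma[OF continuous_orb] setsM measurable_cong_sets by blast
  define N where "N = distr M (borel_sigma quotient_space) orb"
  have sN: "sets N = sets (borel_sigma quotient_space)" by (simp add: N_def)
  have spN: "space N = topspace quotient_space" by (simp add: N_def)
  have sub: "B \<subseteq> topspace quotient_space" if "B \<in> sets N" for B
    using sets.sets_into_space[OF that] spN by simp
  have pre_eq: "orb -` B \<inter> space M = orb_preimage B" for B by (auto simp: orb_preimage_def spM)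
  have preB: "orb_preimage B \<in> sets M" if "B \<in> sets N" for B
    using measurable_sets[OF meas] that pre_eq sN by metis
  have mN: "measure N B = measure M (orb_preimage B)" if "B \<in> sets N" for B
    using measure_distr[OF meas] that pre_eq sN by (simp add: N_def)
  have "ergodic_measure (G Mod H) quotient_space quotient_action N"
    unfolding ergodic_measure_def
  proof (intro conjI ballI impI)
    show "prob_space N" unfolding N_def by (rule prob_space.prob_space_distr[OF psM meas])
    show "sets N = sets (borel_sigma quotient_space)" by (rule sN)
  next
    fix C B assume C: "C \<in> carrier (G Mod H)" and B: "B \<in> sets N"
    then obtain g where g: "g \<in> carrier G" "C = H #> g" by (auto simp: carrier_FactGroup)
    have "quotient_action C ` B \<in> sets N" using sets_quotient_action_image g B sN by simp
    then show "measure N (quotient_action C ` B) = measure N B"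
      using g B invM preB orb_preimage_quotient_action[OF g(1) sub[OF B]] by (simp add: mN)
  next
    fix B assume "B \<in> sets N" "invariant_set (G Mod H) quotient_action B"
    then show "measure N B = 0 \<or> measure N B = 1"
      using ergM[OF preB invariant_orb_preimage] sub by (simp add: mN)
  qed
  moreover have "\<not> essentially_free (G Mod H) quotient_action N"
  proof
    assume "essentially_free (G Mod H) quotient_action N"
    then obtain Z where Z: "Z \<in> null_sets N"
      "{y \<in> space N. stabilizer (G Mod H) quotient_action y \<noteq> {\<one>\<^bsub>G Mod H\<^esub>}} \<subseteq> Z"
      unfolding essentially_free_def by (auto simp: eventually_ae_filter)
    have ZN: "Z \<in> sets N" using Z(1) by (simp add: null_setsD2)
    then have "emeasure M (orb_preimage Z) = 0"
      using Z(1) emeasure_distr[OF meas] pre_eq sN by (auto simp: N_def null_sets_def)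
    then have "orb_preimage Z \<in> null_sets M" using preB[OF ZN] by blast
    moreover have "{x \<in> space M. stabilizer G \<phi> x \<noteq> {\<one>}} \<subseteq> orb_preimage Z"
      using Z(2) stabilizer_quotient_trivial_iff[OF min free] by (auto simp: orb_preimage_def spM spN)
    ultimately have "essentially_free G \<phi> M"
      unfolding essentially_free_def by (auto simp: eventually_ae_filter)
    with nef show False by simp
  qed
  ultimately show ?thesis
    unfolding allosteric_action_def
    using compact_quotient Hausdorff_quotient action_by_homeos_quotient
      minimal_quotient[OF min] topologically_free_quotient[OF min free] by blast
qed

end

section \<open>The equivalence\<close>

theorem corollary4p11:
  fixes G :: "('g, 'm) monoid_scheme"
  assumes "group G" and "countable (carrier G)" and "finitely_generated_group G"
  shows "allosteric G \<longleftrightarrow> (\<forall>H. H \<lhd> G \<and> finite H \<longrightarrow> allosteric (G Mod H))"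
proof
  assume "allosteric G"
  then obtain X :: "nat set set topology" and \<phi> where act: "allosteric_action G X \<phi>"
    unfolding allosteric_def by blast
  show "\<forall>H. H \<lhd> G \<and> finite H \<longrightarrow> allosteric (G Mod H)"
  proof (intro allI impI)
    fix H assume H: "H \<lhd> G \<and> finite H"
    have "finite_normal_action H G X \<phi>"
      using H act
      by (simp add: finite_normal_action_def finite_normal_action_axioms_def
          allosteric_action_def action_by_homeos_def)
    then have "allosteric_action (G Mod H) (finite_normal_action.quotient_space H X \<phi>)
        (finite_normal_action.quotient_action H X \<phi>)"
      using act by (rule finite_normal_action.allosteric_action_quotient)
    moreover have "countable (carrier (G Mod H))"
      using assms(2) by (simp add: carrier_FactGroup)
    ultimately show "allosteric (G Mod H)" by (intro allostericI)
  qed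
next
  assume "\<forall>H. H \<lhd> G \<and> finite H \<longrightarrow> allosteric (G Mod H)"
  then have "allosteric (G Mod {\<one>\<^bsub>G\<^esub>})" using assms(1) by (simp add: group.one_is_normal)
  then obtain X :: "nat set set topology" and \<phi> where "allosteric_action (G Mod {\<one>\<^bsub>G\<^esub>}) X \<phi>"
    unfolding allosteric_def by blast
  then show "allosteric G"
    using allosteric_action_pullback_iso[OF assms(1) iso_factor_trivial_subgroup] assms(1)
    unfolding allosteric_def by blast
qed

end
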